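(* Let $\Omega=\Omega_X\times\Omega_Y$ carry a product reference measure $\mathsf{P}=\mathsf{P}_X\times\mathsf{P}_Y$ and let $f\in\mathcal{B}^2(\mathsf{P})$ be a bivariate density. For the independent part $f_{\mathrm{ind}}$ and the interactive part $f_{\mathrm{int}}$ of $f$ it holds that (i) $\langle f_{\mathrm{ind}},f_{\mathrm{int}}\rangle_{\mathcal{B}^2(\mathsf{P})}=0$, or, equivalently, that (ii) $\langle f^c_{\mathrm{ind}},f^c_{\mathrm{int}}\rangle_{L^2_0(\mathsf{P})}=0$, where $f^c_{\mathrm{ind}}$, $f^c_{\mathrm{int}}$ are the clr transformations of $f_{\mathrm{ind}}$, $f_{\mathrm{int}}$.
   Context: $\mathsf{P}_X$ and $\mathsf{P}_Y$ are measures on $\Omega_X$ and $\Omega_Y$ with $0<\mathsf{P}(\Omega)<\infty$ (no normalization is required). The Bayes space $\mathcal{B}^2(\mathsf{P})$ consists of equivalence classes of positive densities $f$ with respect to $\mathsf{P}$ with $\int_\Omega|\ln f|^2\,d\mathsf{P}<\infty$, where $f$ and $g$ are equivalent (written $f=_{\mathcal{B}^2(\mathsf{P})}g$) if $g=cf$ for some constant $c>0$. Operations: perturbation $f\oplus g=_{\mathcal{B}^2(\mathsf{P})}fg$, powering $\alpha\odot f=_{\mathcal{B}^2(\mathsf{P})}f^\alpha$ for real $\alpha$, and $f\ominus g=f\oplus((-1)\odot g)$. Inner product: $$\langle f,g\rangle_{\mathcal{B}^2(\mathsf{P})}=\frac{1}{2\mathsf{P}(\Omega)}\iint_\Omega\iint_\Omega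 \ln\frac{f(x,y)}{f(s,t)}\,\ln\frac{g(x,y)}{g(s,t)}\,d\mathsf{P}(x,y)\,d\mathsf{P}(s,t).$$ The clr transformation of $f$ is $f^c=\ln f-\frac{1}{\mathsf{P}(\Omega)}\iint_\Omega\ln f\,d\mathsf{P}$; it lies in $L^2_0(\mathsf{P})$, the subspace of $L^2(\mathsf{P})$ of functions with zero integral, with the inner product of $L^2(\mathsf{P})$. The clr marginals of $f$ are $f^c_X(x)=\int_{\Omega_Y}f^c(x,y)\,d\mathsf{P}_Y(y)$ and $f^c_Y(y)=\int_{\Omega_X}f^c(x,y)\,d\mathsf{P}_X(x)$. The geometric marginals are $f_X=\exp(f^c_X)$ and $f_Y=\exp(f^c_Y)$ (up to positive constant factors), viewed also as elements of $\mathcal{B}^2(\mathsf{P})$ constant in the other variable. The independent part of $f$ is $f_{\mathrm{ind}}(x,y)=f_X(x)f_Y(y)$, i.e. $f_{\mathrm{ind}}=f_X\oplus f_Y$, and the interactive part is $f_{\mathrm{int}}(x,y)=\frac{f(x,y)}{f_X(x)f_Y(y)}$, i.e. $f_{\mathrm{int}}=f\ominus f_{\mathrm{ind}}$.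
   Formalization: The geometric marginals are taken as f_X=exp(f^c_X/P_Y(Ω_Y)) and f_Y=exp(f^c_Y/P_X(Ω_X)); with the literal exp(f^c_X), exp(f^c_Y) orthogonality fails for unnormalized measures (e.g. counting measure on a 2×2 set). For probability measures the formulas agree. *)

theory Defs
  imports "HOL-Analysis.Analysis"
begin

text \<open>
  A density is represented by a measurable function that is positive on the whole space. Elements
  of the Bayes space are classes of such functions modulo \<open>bayes_eq\<close>. Since densities are
  only determined up to null sets, the equality up to a constant factor is an equality almost
  everywhere.
\<close>

definition bayes_space :: "'a measure \<Rightarrow> ('a \<Rightarrow> real) set" where
  "bayes_space P = {f \<in> borel_measurable P.
     (\<forall>z\<in>space P. 0 < f z) \<and> integrable P (\<lambda>z. \<bar>ln (f z)\<bar>\<^sup>2)}"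

definition bayes_eq :: "'a measure \<Rightarrow> ('a \<Rightarrow> real) \<Rightarrow> ('a \<Rightarrow> real) \<Rightarrow> bool" where
  "bayes_eq P f g \<longleftrightarrow> (\<exists>c>0. AE z in P. g z = c * f z)"

definition perturb :: "('a \<Rightarrow> real) \<Rightarrow> ('a \<Rightarrow> real) \<Rightarrow> 'a \<Rightarrow> real" where
  "perturb f g = (\<lambda>z. f z * g z)"

definition powering :: "real \<Rightarrow> ('a \<Rightarrow> real) \<Rightarrow> 'a \<Rightarrow> real" where
  "powering a f = (\<lambda>z. f z powr a)"

definition perturb_diff :: "('a \<Rightarrow> real) \<Rightarrow> ('a \<Rightarrow> real) \<Rightarrow> 'a \<Rightarrow> real" where
  "perturb_diff f g = perturb f (powering (-1) g)"

definition bayes_inner :: "'a measure \<Rightarrow> ('a \<Rightarrow> real) \<Rightarrow> ('a \<Rightarrow> real) \<Rightarrow> real" where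
  "bayes_inner P f g = 1 / (2 * measure P (space P)) *
     (\<integral>w. (\<integral>z. ln (f z / f w) * ln (g z / g w) \<partial>P) \<partial>P)"

definition clr :: "'a measure \<Rightarrow> ('a \<Rightarrow> real) \<Rightarrow> 'a \<Rightarrow> real" where
  "clr P f = (\<lambda>z. ln (f z) - 1 / measure P (space P) * (\<integral>w. ln (f w) \<partial>P))"

definition L2_zero :: "'a measure \<Rightarrow> ('a \<Rightarrow> real) set" where
  "L2_zero P = {u \<in> borel_measurable P. integrable P (\<lambda>z. (u z)\<^sup>2) \<and> (\<integral>z. u z \<partial>P) = 0}"

definition L2_inner :: "'a measure \<Rightarrow> ('a \<Rightarrow> real) \<Rightarrow> ('a \<Rightarrow> real) \<Rightarrow> real" where
  "L2_inner P u v = (\<integral>z. u z * v z \<partial>P)"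

definition clr_marginal_X ::
    "'a measure \<Rightarrow> 'b measure \<Rightarrow> ('a \<times> 'b \<Rightarrow> real) \<Rightarrow> 'a \<Rightarrow> real" where
  "clr_marginal_X PX PY f = (\<lambda>x. \<integral>y. clr (PX \<Otimes>\<^sub>M PY) f (x, y) \<partial>PY)"

definition clr_marginal_Y ::
    "'a measure \<Rightarrow> 'b measure \<Rightarrow> ('a \<times> 'b \<Rightarrow> real) \<Rightarrow> 'b \<Rightarrow> real" where
  "clr_marginal_Y PX PY f = (\<lambda>y. \<integral>x. clr (PX \<Otimes>\<^sub>M PY) f (x, y) \<partial>PX)"

text \<open>
  The geometric marginal in \<open>x\<close> is the geometric mean of \<open>f (x, y)\<close> over \<open>y\<close>, up to a constant
  factor. For reference measures of arbitrary finite mass the exponent must therefore be the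
  \<^emph>\<open>average\<close> of the clr transformation, that is, the clr marginal divided by the total mass of the
  variable integrated out. For probability measures this is the usual formula, the exponential of
  the clr marginal; see \<open>geometric_marginal_X_prob\<close> and \<open>geometric_marginal_Y_prob\<close> below.

  Without the division, orthogonality fails. Write \<open>a\<close>, \<open>b\<close> for the clr marginals and \<open>p\<close>, \<open>q\<close>
  for the total masses of \<open>PX\<close>, \<open>PY\<close>. Then the inner product of \<open>a + b\<close> and \<open>clr f - a - b\<close> is
  \<open>(1 - q) * (\<integral>x. (a x)\<^sup>2 \<partial>PX) + (1 - p) * (\<integral>y. (b y)\<^sup>2 \<partial>PY)\<close>. For example, it equals \<open>- 8\<close> for
  counting measure on \<open>bool\<close> in both variables and \<open>f (x, y) = (if x then exp 1 else exp (- 1))\<close>.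
\<close>

definition geometric_marginal_X ::
    "'a measure \<Rightarrow> 'b measure \<Rightarrow> ('a \<times> 'b \<Rightarrow> real) \<Rightarrow> 'a \<Rightarrow> real" where
  "geometric_marginal_X PX PY f =
     (\<lambda>x. exp (1 / measure PY (space PY) * clr_marginal_X PX PY f x))"

definition geometric_marginal_Y ::
    "'a measure \<Rightarrow> 'b measure \<Rightarrow> ('a \<times> 'b \<Rightarrow> real) \<Rightarrow> 'b \<Rightarrow> real" where
  "geometric_marginal_Y PX PY f =
     (\<lambda>y. exp (1 / measure PX (space PX) * clr_marginal_Y PX PY f y))"

lemma geometric_marginal_X_prob:
  assumes "measure PY (space PY) = 1"
  shows "geometric_marginal_X PX PY f x = exp (clr_marginal_X PX PY f x)"
  using assms by (simp add: geometric_marginal_X_def)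

lemma geometric_marginal_Y_prob:
  assumes "measure PX (space PX) = 1"
  shows "geometric_marginal_Y PX PY f y = exp (clr_marginal_Y PX PY f y)"
  using assms by (simp add: geometric_marginal_Y_def)

definition independent_part ::
    "'a measure \<Rightarrow> 'b measure \<Rightarrow> ('a \<times> 'b \<Rightarrow> real) \<Rightarrow> 'a \<times> 'b \<Rightarrow> real" where
  "independent_part PX PY f =
     perturb (\<lambda>(x, y). geometric_marginal_X PX PY f x) (\<lambda>(x, y). geometric_marginal_Y PX PY f y)"

definition interactive_part ::
    "'a measure \<Rightarrow> 'b measure \<Rightarrow> ('a \<times> 'b \<Rightarrow> real) \<Rightarrow> 'a \<times> 'b \<Rightarrow> real" where
  "interactive_part PX PY f = perturb_diff f (independent_part PX PY f)"

end

theory Submission imports Defs begin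

text \<open>
  Divided by the masses integrated out, the clr marginals \<open>a\<close> and \<open>b\<close> are the orthogonal projections
  of \<open>clr f\<close> onto the functions of one variable in \<open>L\<^sup>2\<close>. Hence \<open>clr f - a\<close> is orthogonal to \<open>a\<close> and
  \<open>clr f - b\<close> to \<open>b\<close>, while \<open>a\<close> is orthogonal to \<open>b\<close> since both have zero integral. Therefore
  \<open>a + b\<close>, the clr transformation of the independent part, is orthogonal to \<open>clr f - a - b\<close>, that of
  the interactive part. The clr transformation is an isometry, which settles the Bayes space.
\<close>

section \<open>Products and sums of square-integrable functions\<close>

lemma integrable_mult_of_squares:
  fixes u v :: "'a \<Rightarrow> real"
  assumes [measurable]: "u \<in> borel_measurable M" "v \<in> borel_measurable M"
    and "integrable M (\<lambda>z. (u z)\<^sup>2)" "integrable M (\<lambda>z. (v z)\<^sup>2)"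
  shows "integrable M (\<lambda>z. u z * v z)"
proof (rule Bochner_Integration.integrable_bound)
  show "integrable M (\<lambda>z. (u z)\<^sup>2 + (v z)\<^sup>2)"
    using assms by simp
  have "\<bar>u z * v z\<bar> \<le> (u z)\<^sup>2 + (v z)\<^sup>2" for z
    using zero_le_power2[of "\<bar>u z\<bar> - \<bar>v z\<bar>"] abs_ge_zero[of "u z * v z"]
    unfolding power2_diff abs_mult power2_abs by linarith
  then show "AE z in M. norm (u z * v z) \<le> norm ((u z)\<^sup>2 + (v z)\<^sup>2)"
    by simp
qed measurable

lemma (in finite_measure) integrable_of_square:
  fixes u :: "'a \<Rightarrow> real"
  assumes "u \<in> borel_measurable M" "integrable M (\<lambda>z. (u z)\<^sup>2)"
  shows "integrable M u"
  using integrable_mult_of_squares[of u M "\<lambda>_. 1"] assms by simp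

lemma integrable_square_add:
  fixes u v :: "'a \<Rightarrow> real"
  assumes "u \<in> borel_measurable M" "v \<in> borel_measurable M"
    and "integrable M (\<lambda>z. (u z)\<^sup>2)" "integrable M (\<lambda>z. (v z)\<^sup>2)"
  shows "integrable M (\<lambda>z. (u z + v z)\<^sup>2)"
  using assms integrable_mult_of_squares[OF assms] by (simp add: power2_sum mult.assoc)

lemma integrable_square_diff:
  fixes u v :: "'a \<Rightarrow> real"
  assumes "u \<in> borel_measurable M" "v \<in> borel_measurable M"
    and "integrable M (\<lambda>z. (u z)\<^sup>2)" "integrable M (\<lambda>z. (v z)\<^sup>2)"
  shows "integrable M (\<lambda>z. (u z - v z)\<^sup>2)"
  using integrable_square_add[of u M "\<lambda>z. - v z"] assms by simp

section \<open>The clr transformation: isometry and independence of the representative\<close>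

lemma bayes_space_ln:
  assumes "f \<in> bayes_space P"
  shows "f \<in> borel_measurable P" "(\<lambda>z. ln (f z)) \<in> borel_measurable P"
    "integrable P (\<lambda>z. (ln (f z))\<^sup>2)" "z \<in> space P \<Longrightarrow> 0 < f z"
    "z \<in> space P \<Longrightarrow> f z \<noteq> 0"
  using assms by (auto simp: bayes_space_def order_less_le)

lemma clr_in_L2_zero:
  assumes "finite_measure P" "0 < measure P (space P)" "f \<in> bayes_space P"
  shows "clr P f \<in> L2_zero P"
proof -
  interpret finite_measure P by fact
  note f = bayes_space_ln[OF assms(3)]
  have "integrable P (\<lambda>z. (clr P f z)\<^sup>2)"
    unfolding clr_def by (rule integrable_square_diff) (use f in auto)
  moreover have "(\<integral>z. clr P f z \<partial>P) = 0"
    using integrable_of_square[OF f(2,3)] assms(2) by (simp add: clr_def)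
  ultimately show ?thesis
    using f(2) by (simp add: L2_zero_def clr_def)
qed

text \<open>The centring constants cancel in log-ratios, so
  \<open>ln (f z / f w) = F z - F w\<close>, and likewise for \<open>G\<close>. In the expanded
  product the mixed terms integrate to 0 because \<open>F\<close> and \<open>G\<close> have zero
  integral. The terms \<open>F z * G z\<close> and \<open>F w * G w\<close> each contribute
  \<open>?m * ?I\<close>, and the factor \<open>1 / (2 * ?m)\<close> of \<open>bayes_inner\<close>
  compensates for exactly that.\<close>

lemma bayes_inner_eq_L2_inner_clr:
  assumes "finite_measure P" "0 < measure P (space P)" "f \<in> bayes_space P" "g \<in> bayes_space P"
  shows "bayes_inner P f g = L2_inner P (clr P f) (clr P g)"
proof -
  interpret finite_measure P by fact
  define F G where "F = clr P f" and "G = clr P g"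
  have "F \<in> L2_zero P" "G \<in> L2_zero P"
    unfolding F_def G_def using assms clr_in_L2_zero by blast+
  then have L2: "F \<in> borel_measurable P" "G \<in> borel_measurable P"
      "integrable P (\<lambda>z. (F z)\<^sup>2)" "integrable P (\<lambda>z. (G z)\<^sup>2)"
    and zero: "(\<integral>z. F z \<partial>P) = 0" "(\<integral>z. G z \<partial>P) = 0"
    by (auto simp: L2_zero_def)
  have int: "integrable P F" "integrable P G" "integrable P (\<lambda>z. F z * G z)"
    using L2 by (auto intro: integrable_of_square integrable_mult_of_squares)
  let ?m = "measure P (space P)" and ?I = "\<integral>z. F z * G z \<partial>P"
  have inner: "(\<integral>z. ln (f z / f w) * ln (g z / g w) \<partial>P) = ?I + ?m * (F w * G w)"
    if "w \<in> space P" for w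
  proof -
    have "(\<integral>z. ln (f z / f w) * ln (g z / g w) \<partial>P) =
        (\<integral>z. F z * G z - G w * F z - F w * G z + F w * G w \<partial>P)"
    proof (rule Bochner_Integration.integral_cong[OF refl])
      fix z assume "z \<in> space P"
      then have ln: "ln (f z / f w) = F z - F w" "ln (g z / g w) = G z - G w"
        using that bayes_space_ln(5)[OF assms(3)] bayes_space_ln(5)[OF assms(4)]
        by (simp_all add: F_def G_def clr_def ln_div)
      show "ln (f z / f w) * ln (g z / g w) = F z * G z - G w * F z - F w * G z + F w * G w"
        unfolding ln by (simp add: algebra_simps)
    qed
    also have "\<dots> = ?I + ?m * (F w * G w)"
      using int zero by simp
    finally show ?thesis .
  qed
  have "(\<integral>w. (\<integral>z. ln (f z / f w) * ln (g z / g w) \<partial>P) \<partial>P) = (\<integral>w. ?I + ?m * (F w * G w) \<partial>P)"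
    using inner by (rule Bochner_Integration.integral_cong[OF refl])
  also have "\<dots> = 2 * ?m * ?I"
    using int by simp
  finally show ?thesis
    using assms(2) by (simp add: bayes_inner_def L2_inner_def F_def G_def)
qed

text \<open>A factor \<open>c\<close> adds \<open>ln c\<close> both to the logarithm and to its
  average, so it disappears on centring. The result holds only almost everywhere because
  \<open>bayes_eq\<close> does.\<close>

lemma clr_cong_bayes_eq:
  assumes "finite_measure P" "0 < measure P (space P)" "f \<in> bayes_space P" "g \<in> bayes_space P"
    and "bayes_eq P f g"
  shows "AE z in P. clr P g z = clr P f z"
proof -
  interpret finite_measure P by fact
  note f = bayes_space_ln[OF assms(3)] and g = bayes_space_ln[OF assms(4)]
  obtain c where c: "c > 0" "AE z in P. g z = c * f z"
    using assms(5) by (auto simp: bayes_eq_def)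
  have ln: "AE z in P. ln (g z) = ln c + ln (f z)"
    using c(2) AE_space by eventually_elim (use c(1) f(5) in \<open>simp add: ln_mult\<close>)
  have "(\<integral>z. ln (g z) \<partial>P) = (\<integral>z. ln c + ln (f z) \<partial>P)"
    by (rule integral_cong_AE) (use f g ln in auto)
  also have "\<dots> = measure P (space P) * ln c + (\<integral>z. ln (f z) \<partial>P)"
    using integrable_of_square[OF f(2,3)] by simp
  finally have mean: "(\<integral>z. ln (g z) \<partial>P) = measure P (space P) * ln c + (\<integral>z. ln (f z) \<partial>P)" .
  show ?thesis
    using ln by eventually_elim (use assms(2) mean in \<open>simp add: clr_def field_simps\<close>)
qed

text \<open>Carries orthogonality from the explicit formulas for the two parts over to arbitrary
  representatives of their classes.\<close>

lemma L2_inner_clr_cong_bayes_eq: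
  assumes "finite_measure P" "0 < measure P (space P)"
    and "f \<in> bayes_space P" "f' \<in> bayes_space P" "bayes_eq P f f'"
    and "g \<in> bayes_space P" "g' \<in> bayes_space P" "bayes_eq P g g'"
  shows "L2_inner P (clr P f') (clr P g') = L2_inner P (clr P f) (clr P g)"
  unfolding L2_inner_def
proof (rule integral_cong_AE)
  have "clr P u \<in> borel_measurable P" if "u \<in> bayes_space P" for u
    using clr_in_L2_zero[OF assms(1,2) that] by (simp add: L2_zero_def)
  then show "(\<lambda>z. clr P f' z * clr P g' z) \<in> borel_measurable P"
    "(\<lambda>z. clr P f z * clr P g z) \<in> borel_measurable P"
    using assms by auto
  show "AE z in P. clr P f' z * clr P g' z = clr P f z * clr P g z"
    using clr_cong_bayes_eq[OF assms(1-5)] clr_cong_bayes_eq[OF assms(1,2,6-8)]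
    by eventually_elim simp
qed

section \<open>Product measures and averaging over one variable\<close>

lemma finite_measure_pair:
  assumes "finite_measure M" "finite_measure N"
  shows "finite_measure (M \<Otimes>\<^sub>M N)"
    and "measure (M \<Otimes>\<^sub>M N) (space (M \<Otimes>\<^sub>M N)) = measure M (space M) * measure N (space N)"
proof -
  interpret M: finite_measure M by fact
  interpret N: finite_measure N by fact
  have eq: "emeasure (M \<Otimes>\<^sub>M N) (space (M \<Otimes>\<^sub>M N)) = emeasure M (space M) * emeasure N (space N)"
    by (simp add: space_pair_measure N.emeasure_pair_measure_Times)
  show "finite_measure (M \<Otimes>\<^sub>M N)"
    by (rule finite_measureI)
      (simp add: eq ennreal_mult_eq_top_iff M.emeasure_finite N.emeasure_finite)
  show "measure (M \<Otimes>\<^sub>M N) (space (M \<Otimes>\<^sub>M N)) = measure M (space M) * measure N (space N)"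
    by (simp add: measure_def eq enn2real_mult)
qed

text \<open>The conditional expectation of \<open>h\<close> given the first variable, for
  \<open>N\<close> normalized to a probability measure. With \<open>h = clr f\<close> it is the
  exponent of the geometric marginal in x. It is kept general in the measure and in \<open>h\<close>
  so that the marginal in y is covered too, after swapping the coordinates.\<close>

definition section_mean :: "'b measure \<Rightarrow> ('a \<times> 'b \<Rightarrow> real) \<Rightarrow> 'a \<Rightarrow> real" where
  "section_mean N h x = 1 / measure N (space N) * (\<integral>y. h (x, y) \<partial>N)"

context
  fixes M :: "'a measure" and N :: "'b measure" and h :: "'a \<times> 'b \<Rightarrow> real"
  assumes M: "finite_measure M" and N: "finite_measure N" "0 < measure N (space N)"
    and h: "h \<in> borel_measurable (M \<Otimes>\<^sub>M N)" "integrable (M \<Otimes>\<^sub>M N) (\<lambda>z. (h z)\<^sup>2)"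
begin

interpretation M: finite_measure M by (rule M)
interpretation N: finite_measure N by (rule N)
interpretation MN: pair_sigma_finite M N ..
interpretation P: finite_measure "M \<Otimes>\<^sub>M N" using M N(1) by (rule finite_measure_pair)

lemma section_mean_measurable: "section_mean N h \<in> borel_measurable M"
  unfolding section_mean_def using h(1) by measurable

lemma section_mean_fst_measurable: "(\<lambda>z. section_mean N h (fst z)) \<in> borel_measurable (M \<Otimes>\<^sub>M N)"
  using section_mean_measurable by simp

text \<open>The squared average is dominated by the average of the square, which is integrable over
  \<open>M\<close> by Fubini. The bound is shown for almost every x, namely where the section of
  \<open>h\<close> is square integrable.\<close>

lemma integrable_square_section_mean: "integrable M (\<lambda>x. (section_mean N h x)\<^sup>2)"
proof (rule Bochner_Integration.integrable_bound)
  let ?q = "measure N (space N)"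
  show "integrable M (\<lambda>x. 1 / ?q * (\<integral>y. (h (x, y))\<^sup>2 \<partial>N))"
    using MN.integrable_fst'[OF h(2)] by simp
  show "(\<lambda>x. (section_mean N h x)\<^sup>2) \<in> borel_measurable M"
    using section_mean_measurable by simp
  show "AE x in M. norm ((section_mean N h x)\<^sup>2) \<le> norm (1 / ?q * (\<integral>y. (h (x, y))\<^sup>2 \<partial>N))"
    using MN.AE_integrable_fst'[OF h(2)] AE_space
  proof eventually_elim
    case (elim x)
    let ?m = "section_mean N h x"
    have "(\<lambda>y. h (x, y)) \<in> borel_measurable N"
      using h(1) elim(2) by measurable
    then have int: "integrable N (\<lambda>y. h (x, y))"
      using elim(1) by (rule N.integrable_of_square)
    \<comment> \<open>Jensen's inequality, from the nonnegativity of the variance of the section\<close>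
    have "0 \<le> (\<integral>y. (h (x, y) - ?m)\<^sup>2 \<partial>N)"
      by simp
    also have "\<dots> = (\<integral>y. (h (x, y))\<^sup>2 - 2 * ?m * h (x, y) + ?m\<^sup>2 \<partial>N)"
      by (rule arg_cong[of _ _ "integral\<^sup>L N"]) (simp add: fun_eq_iff power2_diff algebra_simps)
    also have "\<dots> = (\<integral>y. (h (x, y))\<^sup>2 \<partial>N) - 2 * ?m * (\<integral>y. h (x, y) \<partial>N) + ?q * ?m\<^sup>2"
      using int elim(1) by simp
    also have "(\<integral>y. h (x, y) \<partial>N) = ?q * ?m"
      using N(2) by (simp add: section_mean_def)
    finally have "?m\<^sup>2 * ?q \<le> (\<integral>y. (h (x, y))\<^sup>2 \<partial>N)"
      by (simp add: power2_eq_square mult.commute mult.left_commute)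
    then have "?m\<^sup>2 \<le> 1 / ?q * (\<integral>y. (h (x, y))\<^sup>2 \<partial>N)"
      using N(2) by (simp add: pos_le_divide_eq)
    then show ?case
      by (smt (verit) real_norm_def zero_le_power2)
  qed
qed

lemma integrable_square_section_mean_fst:
  "integrable (M \<Otimes>\<^sub>M N) (\<lambda>z. (section_mean N h (fst z))\<^sup>2)"
proof (rule MN.Fubini_integrable)
  show "(\<lambda>z. (section_mean N h (fst z))\<^sup>2) \<in> borel_measurable (M \<Otimes>\<^sub>M N)"
    using section_mean_fst_measurable by simp
qed (use integrable_square_section_mean in simp_all)

text \<open>The integral is over \<open>M\<close> alone. In this form it shows that the average of a
  function with zero integral has zero integral in its own variable, which makes averages in
  different variables orthogonal.\<close>

lemma integral_section_mean:
  "(\<integral>x. section_mean N h x \<partial>M) = 1 / measure N (space N) * (\<integral>z. h z \<partial>(M \<Otimes>\<^sub>M N))"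
  using MN.integral_fst'[OF P.integrable_of_square[OF h]] by (simp add: section_mean_def)

lemma integral_section_mean_fst:
  "(\<integral>z. section_mean N h (fst z) \<partial>(M \<Otimes>\<^sub>M N)) = (\<integral>z. h z \<partial>(M \<Otimes>\<^sub>M N))"
proof -
  have "integrable (M \<Otimes>\<^sub>M N) (\<lambda>z. section_mean N h (fst z))"
    by (rule P.integrable_of_square[OF section_mean_fst_measurable
          integrable_square_section_mean_fst])
  from MN.integral_fst'[OF this] show ?thesis
    using N(2) by (simp add: integral_section_mean)
qed

text \<open>The projection property: the average does not depend on y and leaves the inner integral,
  where the deviation of \<open>h\<close> from its average integrates to 0 over almost every
  section.\<close>

lemma section_mean_orthogonal:
  "(\<integral>z. section_mean N h (fst z) * (h z - section_mean N h (fst z)) \<partial>(M \<Otimes>\<^sub>M N)) = 0"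
proof -
  note m = section_mean_fst_measurable integrable_square_section_mean_fst
  have "integrable (M \<Otimes>\<^sub>M N) (\<lambda>z. section_mean N h (fst z) * (h z - section_mean N h (fst z)))"
    using m h by (intro integrable_mult_of_squares integrable_square_diff) auto
  from MN.integral_fst'[OF this]
  have "(\<integral>z. section_mean N h (fst z) * (h z - section_mean N h (fst z)) \<partial>(M \<Otimes>\<^sub>M N)) =
      (\<integral>x. section_mean N h x * (\<integral>y. h (x, y) - section_mean N h x \<partial>N) \<partial>M)"
    by simp
  also have "\<dots> = (\<integral>x. 0 \<partial>M)"
  proof (rule integral_cong_AE)
    show "AE x in M. section_mean N h x * (\<integral>y. h (x, y) - section_mean N h x \<partial>N) = 0"
      using MN.AE_integrable_fst'[OF P.integrable_of_square[OF h]]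
    proof eventually_elim
      case (elim x)
      then have "(\<integral>y. h (x, y) - section_mean N h x \<partial>N) =
          (\<integral>y. h (x, y) \<partial>N) - measure N (space N) * section_mean N h x"
        by simp
      then show ?case
        using N(2) by (simp add: section_mean_def)
    qed
    show "(\<lambda>x. section_mean N h x * (\<integral>y. h (x, y) - section_mean N h x \<partial>N))
        \<in> borel_measurable M"
      using h(1) section_mean_measurable by measurable
  qed simp
  finally show ?thesis
    by simp
qed

end

section \<open>The independent and the interactive part\<close>

text \<open>Treats the representatives given by the formulas, whose clr transformations can be
  computed explicitly. Membership in \<open>bayes_space\<close> is included because the passage to
  other representatives requires it.\<close>

lemma independent_interactive_part:
  fixes PX :: "'a measure" and PY :: "'b measure" and f :: "'a \<times> 'b \<Rightarrow> real"
  defines "P \<equiv> PX \<Otimes>\<^sub>M PY"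
  assumes fin: "finite_measure PX" "finite_measure PY"
    and pos: "0 < measure PX (space PX)" "0 < measure PY (space PY)"
    and f: "f \<in> bayes_space P"
  shows "independent_part PX PY f \<in> bayes_space P"
    and "interactive_part PX PY f \<in> bayes_space P"
    and "L2_inner P (clr P (independent_part PX PY f)) (clr P (interactive_part PX PY f)) = 0"
proof -
  interpret X: finite_measure PX by fact
  interpret Y: finite_measure PY by fact
  interpret XY: pair_sigma_finite PX PY ..
  interpret YX: pair_sigma_finite PY PX ..
  have P: "finite_measure P" "0 < measure P (space P)"
    unfolding P_def using fin pos by (simp_all add: finite_measure_pair)
  interpret P: finite_measure P by (rule P)
  define g where "g = clr P f"
  \<comment> \<open>With the coordinates swapped, averaging over x becomes a
    \<open>section_mean\<close>.\<close>
  define g' where "g' = (\<lambda>(y, x). g (x, y))"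
  have g: "g \<in> borel_measurable P" "integrable P (\<lambda>z. (g z)\<^sup>2)" "(\<integral>z. g z \<partial>P) = 0"
    using clr_in_L2_zero[OF P f] by (auto simp: g_def L2_zero_def)
  have g'[measurable]: "g' \<in> borel_measurable (PY \<Otimes>\<^sub>M PX)"
    unfolding g'_def using g(1) by (simp add: P_def measurable_pair_swap)
  have g'2: "integrable (PY \<Otimes>\<^sub>M PX) (\<lambda>z. (g' z)\<^sup>2)"
    using XY.integrable_product_swap[OF g(2)[unfolded P_def]]
    by (simp add: g'_def case_prod_unfold)
  have g'0: "(\<integral>z. g' z \<partial>(PY \<Otimes>\<^sub>M PX)) = 0"
    using XY.integral_product_swap[of g] g(1,3) by (simp add: g'_def P_def)
  define m where "m = section_mean PY g"
  define n where "n = section_mean PX g'"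
  define a where "a = (\<lambda>z::'a \<times> 'b. m (fst z))"
  define b where "b = (\<lambda>z::'a \<times> 'b. n (snd z))"
  note hX = fin pos(2) g(1,2)[unfolded P_def]
  note hY = fin(2,1) pos(1) g' g'2
  have a: "a \<in> borel_measurable P" "integrable P (\<lambda>z. (a z)\<^sup>2)" "(\<integral>z. a z \<partial>P) = 0"
    using section_mean_fst_measurable[OF hX] integrable_square_section_mean_fst[OF hX]
      integral_section_mean_fst[OF hX] g(3) by (simp_all add: a_def m_def P_def)
  have n: "n \<in> borel_measurable PY" "(\<integral>y. n y \<partial>PY) = 0"
    using section_mean_measurable[OF hY] integral_section_mean[OF hY] g'0 by (simp_all add: n_def)
  have b: "b \<in> borel_measurable P"
    using n(1) by (simp add: b_def P_def)
  have b2: "integrable P (\<lambda>z. (b z)\<^sup>2)"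
    using YX.integrable_product_swap[OF integrable_square_section_mean_fst[OF hY]]
    by (simp add: b_def n_def P_def case_prod_unfold)
  have swap: "(\<integral>z. u (snd z, fst z) \<partial>P) = (\<integral>z. u z \<partial>(PY \<Otimes>\<^sub>M PX))"
    if "u \<in> borel_measurable (PY \<Otimes>\<^sub>M PX)" for u :: "'b \<times> 'a \<Rightarrow> real"
    using YX.integral_product_swap[OF that] by (simp add: P_def case_prod_unfold)
  have b0: "(\<integral>z. b z \<partial>P) = 0"
    using swap[OF section_mean_fst_measurable[OF hY]] integral_section_mean_fst[OF hY] g'0
    by (simp add: b_def n_def)
  have ag: "(\<integral>z. a z * (g z - a z) \<partial>P) = 0"
    using section_mean_orthogonal[OF hX] by (simp add: a_def m_def P_def)
  have "(\<integral>z. b z * (g z - b z) \<partial>P) = (\<integral>z. n (fst z) * (g' z - n (fst z)) \<partial>(PY \<Otimes>\<^sub>M PX))"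
  proof -
    have "(\<lambda>z. n (fst z) * (g' z - n (fst z))) \<in> borel_measurable (PY \<Otimes>\<^sub>M PX)"
      using n(1) by measurable
    from swap[OF this] show ?thesis
      by (simp add: b_def g'_def)
  qed
  then have bg: "(\<integral>z. b z * (g z - b z) \<partial>P) = 0"
    using section_mean_orthogonal[OF hY] by (simp add: n_def)
  have int_ab: "integrable P (\<lambda>z. a z * b z)"
    using a b b2 by (intro integrable_mult_of_squares) auto
  \<comment> \<open>For fixed x the integral over y is \<open>m x\<close> times the integral of
    \<open>n\<close>, which is 0.\<close>
  have ab: "(\<integral>z. a z * b z \<partial>P) = 0"
    using XY.integral_fst'[OF int_ab[unfolded P_def]] n(2) by (simp add: a_def b_def P_def)

  \<comment> \<open>The exponents of the geometric marginals are exactly \<open>m\<close> and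
    \<open>n\<close>, so no constant factor is left over.\<close>
  have ind: "independent_part PX PY f = (\<lambda>z. exp (a z + b z))"
    by (simp add: fun_eq_iff independent_part_def perturb_def geometric_marginal_X_def
        geometric_marginal_Y_def clr_marginal_X_def clr_marginal_Y_def a_def b_def m_def n_def
        section_mean_def g_def g'_def P_def exp_add)
  have int: "interactive_part PX PY f = (\<lambda>z. f z * exp (- (a z + b z)))"
    by (simp add: interactive_part_def ind perturb_diff_def perturb_def powering_def powr_def)
  note lnf = bayes_space_ln[OF f]
  have ln_int: "ln (f z * exp (- (a z + b z))) = ln (f z) - (a z + b z)" if "z \<in> space P" for z
    using lnf(4)[OF that] by (simp add: ln_mult)
  have s: "(\<lambda>z. a z + b z) \<in> borel_measurable P" "integrable P (\<lambda>z. (a z + b z)\<^sup>2)"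
    "(\<integral>z. a z + b z \<partial>P) = 0" "integrable P (\<lambda>z. a z + b z)"
    using a b b2 b0 by (simp_all add: integrable_square_add P.integrable_of_square)
  show "independent_part PX PY f \<in> bayes_space P"
    using s by (simp add: ind bayes_space_def)
  have "integrable P (\<lambda>z. (ln (f z) - (a z + b z))\<^sup>2)"
    using s lnf by (intro integrable_square_diff) auto
  then have "integrable P (\<lambda>z. \<bar>ln (f z * exp (- (a z + b z)))\<bar>\<^sup>2)"
    using ln_int by (simp cong: Bochner_Integration.integrable_cong)
  then show "interactive_part PX PY f \<in> bayes_space P"
    using s(1) a(1) b lnf by (simp add: int bayes_space_def)

  \<comment> \<open>The logarithm \<open>a + b\<close> already has zero integral, so centring does
    not change it. For the same reason, dividing \<open>f\<close> by the independent part does not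
    change the integral of the logarithm, which gives \<open>clr_int\<close> below.\<close>
  have clr_ind: "clr P (independent_part PX PY f) = (\<lambda>z. a z + b z)"
    using s(3) by (simp add: clr_def ind)
  have "(\<integral>z. ln (f z * exp (- (a z + b z))) \<partial>P) = (\<integral>z. ln (f z) - (a z + b z) \<partial>P)"
    using ln_int by (rule Bochner_Integration.integral_cong[OF refl])
  also have "\<dots> = (\<integral>z. ln (f z) \<partial>P)"
    using s P.integrable_of_square[OF lnf(2,3)] by (simp add: Bochner_Integration.integral_diff)
  finally have clr_int: "clr P (interactive_part PX PY f) z = g z - a z - b z"
    if "z \<in> space P" for z
    using ln_int[OF that] by (simp add: clr_def int g_def)
  \<comment> \<open>The product \<open>(a + b) * (g - a - b)\<close> is regrouped into the three
    integrands treated in \<open>ag\<close>, \<open>bg\<close> and \<open>ab\<close>.\<close>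
  have "L2_inner P (clr P (independent_part PX PY f)) (clr P (interactive_part PX PY f)) =
      (\<integral>z. a z * (g z - a z) + b z * (g z - b z) - 2 * (a z * b z) \<partial>P)"
    unfolding L2_inner_def clr_ind
    by (rule Bochner_Integration.integral_cong[OF refl]) (simp add: clr_int algebra_simps)
  also have "\<dots> = (\<integral>z. a z * (g z - a z) \<partial>P) + (\<integral>z. b z * (g z - b z) \<partial>P)
      - 2 * (\<integral>z. a z * b z \<partial>P)"
  proof -
    have "integrable P (\<lambda>z. a z * (g z - a z))" "integrable P (\<lambda>z. b z * (g z - b z))"
      using a b b2 g by (auto intro!: integrable_mult_of_squares integrable_square_diff)
    then show ?thesis
      using int_ab by (simp add: Bochner_Integration.integral_diff Bochner_Integration.integral_add
          del: mult_eq_0_iff)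
  qed
  finally show "L2_inner P (clr P (independent_part PX PY f)) (clr P (interactive_part PX PY f)) = 0"
    using ag bg ab by simp
qed

text \<open>Elements of the Bayes space are classes, hence the quantification over all
  representatives \<open>f_ind\<close> and \<open>f_int\<close> of the two parts.\<close>

theorem theorem3p1:
  fixes PX :: "'a measure" and PY :: "'b measure" and f :: "'a \<times> 'b \<Rightarrow> real"
  defines "P \<equiv> PX \<Otimes>\<^sub>M PY"
  assumes "finite_measure PX" and "0 < measure PX (space PX)"
    and "finite_measure PY" and "0 < measure PY (space PY)"
    and "f \<in> bayes_space P"
  shows "independent_part PX PY f \<in> bayes_space P \<and> interactive_part PX PY f \<in> bayes_space P \<and>
    (\<forall>f_ind\<in>bayes_space P. \<forall>f_int\<in>bayes_space P.
       bayes_eq P (independent_part PX PY f) f_ind \<longrightarrow>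
       bayes_eq P (interactive_part PX PY f) f_int \<longrightarrow>
         bayes_inner P f_ind f_int = 0 \<and>
         clr P f_ind \<in> L2_zero P \<and> clr P f_int \<in> L2_zero P \<and>
         L2_inner P (clr P f_ind) (clr P f_int) = 0)"
proof -
  have P: "finite_measure P" "0 < measure P (space P)"
    unfolding P_def using assms(2-5) by (simp_all add: finite_measure_pair)
  note parts = independent_interactive_part[OF assms(2,4,3,5) assms(6)[unfolded P_def],
      folded P_def]
  \<comment> \<open>Claim (ii) passes from the explicit parts to \<open>f_ind\<close> and
    \<open>f_int\<close> by invariance under \<open>bayes_eq\<close>; claim (i) then follows from
    the isometry.\<close>
  show ?thesis
    using parts(1,2) clr_in_L2_zero[OF P] bayes_inner_eq_L2_inner_clr[OF P]
      L2_inner_clr_cong_bayes_eq[OF P parts(1) _ _ parts(2)] parts(3)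
    by simp
qed

end
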